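(* Let $\gamma_0,\gamma_1,\gamma_2$ and the amplification polynomial $\Theta(\delta x,\delta\tau,\theta)=\gamma_0p^2-2\gamma_1p-\gamma_2$ (in the variable $p$) of the three-time-level compact scheme $$\frac{U_n^{m+1}-U_n^{m-1}}{2\delta\tau}=\mathbb{D}_\delta\Big(\frac{U_n^{m+1}+U_n^{m-1}}{2}\Big)+\mathbb{I}_\delta U_n^m-(r+\lambda)U_n^m,\qquad 1\le m\le M-1,$$ be as defined in the context. Then the scheme is stable in the sense of von Neumann for $\delta\tau\le \frac{1}{4\lambda+2r}$. That is, under this restriction on $\delta\tau$: (1) there is a constant $C$ (independent of $\delta x,\delta\tau,\theta$) such that every root $p_u$ of $\Theta$ satisfies $|p_u|\le 1+C\delta\tau$; (2) there are positive constants $a_0$ and $a_1$ (independent of $\delta x,\delta\tau,\theta$) such that if $a_0<|p_u|\le1+C\delta\tau$ then $p_u$ is a simple root and every other root $p_v$ of $\Theta$ satisfies $|p_v-p_u|\ge a_1$, as $\delta x,\delta\tau\to0$.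
   Context: Parameters: $\sigma>0$, risk-free rate $r\ge0$, jump intensity $\lambda>0$, $L>0$, $T>0$. The jump density $g$ is either the Merton density $g(x)=\frac{1}{\sqrt{2\pi\sigma_J^2}}e^{-(x-\mu_J)^2/(2\sigma_J^2)}$ with $\mu_J\in\mathbb{R}$, $\sigma_J>0$, or the Kou density $g(x)=(1-p_0)\lambda_+e^{-\lambda_+x}1_{x\ge0}+p_0\lambda_-e^{\lambda_-x}1_{x<0}$ with $\lambda_->0$, $\lambda_+>1$, $0\le p_0\le1$. Put $\zeta=\int_{\mathbb{R}}(e^x-1)g(x)\,dx$, $a=\frac{\sigma^2}{2}$ and $b=r-\frac{\sigma^2}{2}-\lambda\zeta$. Grid: $\delta x=2L/N$ with $N$ even, $\delta\tau=T/M$, $x_n=-L+n\delta x$, $\tau_m=m\delta\tau$. Scheme: $\mathbb{D}_\delta U_n^m=a\,U_{xx_n}^m+b\,U_{x_n}^m$, where the compact first-derivative approximation is defined by $\tfrac14U_{x_{n-1}}+U_{x_n}+\tfrac14U_{x_{n+1}}=\frac{3}{4\delta x}(U_{n+1}-U_{n-1})$ and the compact second-derivative approximation by $U_{xx_n}=2\frac{U_{n+1}-2U_n+U_{n-1}}{\delta x^2}-\frac{U_{x_{n+1}}-U_{x_{n-1}}}{2\delta x}$. The integral term $\mathbb{I}u(x,\tau)=\lambda\int_{-L}^{L}u(y+x,\tau)g(y)\,dy$ is discretized by the composite Simpson rule. Von Neumann analysis: substituting a single mode $U_n^m=p^me^{in\theta}$ ($i=\sqrt{-1}$, $p^m$ the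 $m$-th power of the amplitude $p$), the Simpson-discretized integral term acts as multiplication of $U_n^m$ by $\lambda G_k$, where $$G_k=\delta x\sum_{k=0}^{N}w_ke^{i\theta k}g(x_k),$$ and $w_k$ are the composite Simpson weights: $w_0=w_N=\frac13$, $w_k=\frac43$ for odd $k$, $w_k=\frac23$ for even $k$ with $0<k<N$ ($k$ is only a summation index; $G_k$ is a single number depending on $\theta$ and $N$). The scheme then yields $\Theta(\delta x,\delta\tau,\theta)=\gamma_0p^2-2\gamma_1p-\gamma_2=0$ with $$\gamma_0=1-\delta\tau\left(a\frac{\cos^2\theta+4\cos\theta-5}{\delta x^2(2+\cos\theta)}+ib\frac{3\sin\theta}{\delta x(2+\cos\theta)}\right),$$ $$\gamma_1=\lambda\delta\tau\,G_k-\delta\tau(r+\lambda),$$ $$\gamma_2=1+\delta\tau\left(a\frac{\cos^2\theta+4\cos\theta-5}{\delta x^2(2+\cos\theta)}+ib\frac{3\sin\theta}{\delta x(2+\cos\theta)}\right).$$ The phase $\theta$ ranges over $[-\pi,\pi]$. Stability in the sense of von Neumann means that the roots of $\Theta$ satisfy conditions (1) and (2) of the claim. *)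

theory Defs
  imports "HOL-Probability.Probability" "HOL-Computational_Algebra.Polynomial"
begin

definition kou_density :: "real \<Rightarrow> real \<Rightarrow> real \<Rightarrow> real \<Rightarrow> real" where
  "kou_density p0 lam_minus lam_plus x =
     (if x \<ge> 0 then (1 - p0) * lam_plus * exp (- lam_plus * x)
      else p0 * lam_minus * exp (lam_minus * x))"

text \<open>The Merton density is the library's normal density.\<close>

definition jump_density :: "(real \<Rightarrow> real) \<Rightarrow> bool" where
  "jump_density g \<longleftrightarrow>
     (\<exists>\<mu>J \<sigma>J. \<sigma>J > 0 \<and> g = normal_density \<mu>J \<sigma>J) \<or>
     (\<exists>p0 lam_minus lam_plus. lam_minus > 0 \<and> lam_plus > 1 \<and> 0 \<le> p0 \<and> p0 \<le> 1 \<and>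
        g = kou_density p0 lam_minus lam_plus)"

definition jump_mean :: "(real \<Rightarrow> real) \<Rightarrow> real" where
  "jump_mean g = (\<integral>x. (exp x - 1) * g x \<partial>lborel)"

definition diffusion_coeff :: "real \<Rightarrow> real" where
  "diffusion_coeff \<sigma> = \<sigma>\<^sup>2 / 2"

definition drift_coeff :: "real \<Rightarrow> real \<Rightarrow> real \<Rightarrow> (real \<Rightarrow> real) \<Rightarrow> real" where
  "drift_coeff \<sigma> r lam g = r - \<sigma>\<^sup>2 / 2 - lam * jump_mean g"

definition space_step :: "real \<Rightarrow> nat \<Rightarrow> real" where
  "space_step L N = 2 * L / real N"

definition time_step :: "real \<Rightarrow> nat \<Rightarrow> real" where
  "time_step T M = T / real M"

definition grid_point :: "real \<Rightarrow> nat \<Rightarrow> nat \<Rightarrow> real" where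
  "grid_point L N n = - L + real n * space_step L N"

definition simpson_weight :: "nat \<Rightarrow> nat \<Rightarrow> real" where
  "simpson_weight N k = (if k = 0 \<or> k = N then 1/3 else if odd k then 4/3 else 2/3)"

text \<open>The number \<open>G\<^sub>k\<close>; since \<open>k\<close> is only its summation index, it is not an argument.\<close>

definition simpson_symbol :: "(real \<Rightarrow> real) \<Rightarrow> real \<Rightarrow> nat \<Rightarrow> real \<Rightarrow> complex" where
  "simpson_symbol g L N \<theta> =
     complex_of_real (space_step L N) *
       (\<Sum>k=0..N. complex_of_real (simpson_weight N k) * exp (\<i> * complex_of_real (\<theta> * real k))
                 * complex_of_real (g (grid_point L N k)))"

text \<open>The factor by which the compact discretisation of \<open>a u\<^sub>x\<^sub>x + b u\<^sub>x\<close> with spatial step \<open>dx\<close>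
  multiplies the mode \<open>exp (\<i> n \<theta>)\<close>.\<close>

definition compact_symbol :: "real \<Rightarrow> real \<Rightarrow> real \<Rightarrow> real \<Rightarrow> complex" where
  "compact_symbol a b dx \<theta> =
     complex_of_real (a * (((cos \<theta>)\<^sup>2 + 4 * cos \<theta> - 5) / (dx\<^sup>2 * (2 + cos \<theta>)))) +
     \<i> * complex_of_real (b * (3 * sin \<theta> / (dx * (2 + cos \<theta>))))"

definition gamma0 :: "real \<Rightarrow> real \<Rightarrow> real \<Rightarrow> real \<Rightarrow> real \<Rightarrow> complex" where
  "gamma0 a b dx dt \<theta> = 1 - complex_of_real dt * compact_symbol a b dx \<theta>"

definition gamma1 :: "real \<Rightarrow> real \<Rightarrow> real \<Rightarrow> complex \<Rightarrow> complex" where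
  "gamma1 r lam dt G = complex_of_real (lam * dt) * G - complex_of_real (dt * (r + lam))"

definition gamma2 :: "real \<Rightarrow> real \<Rightarrow> real \<Rightarrow> real \<Rightarrow> real \<Rightarrow> complex" where
  "gamma2 a b dx dt \<theta> = 1 + complex_of_real dt * compact_symbol a b dx \<theta>"

text \<open>The polynomial \<open>\<gamma>\<^sub>0 p\<^sup>2 - 2 \<gamma>\<^sub>1 p - \<gamma>\<^sub>2\<close> in \<open>p\<close>. The spatial step enters through the
  number \<open>N\<close> of grid cells, on which the Simpson sum depends.\<close>

definition amplification_poly ::
  "real \<Rightarrow> real \<Rightarrow> real \<Rightarrow> (real \<Rightarrow> real) \<Rightarrow> real \<Rightarrow> nat \<Rightarrow> real \<Rightarrow> real \<Rightarrow> complex poly" where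
  "amplification_poly \<sigma> r lam g L N dt \<theta> =
     (let a = diffusion_coeff \<sigma>; b = drift_coeff \<sigma> r lam g; dx = space_step L N
      in [: - gamma2 a b dx dt \<theta>,
            - 2 * gamma1 r lam dt (simpson_symbol g L N \<theta>),
            gamma0 a b dx dt \<theta> :])"

end

theory Submission
  imports Defs
begin

text \<open>
  The discrete operator has a symbol with nonpositive real part, so
  \<open>\<bar>\<gamma>\<^sub>0\<bar> \<ge> 1\<close> and \<open>\<bar>\<gamma>\<^sub>2\<bar> \<le> \<bar>\<gamma>\<^sub>0\<bar>\<close>. The jump density is bounded, so the Simpson sums are
  bounded uniformly in the grid and \<open>\<bar>\<gamma>\<^sub>1\<bar> \<le> K \<delta>\<tau>\<close>. Hence a root satisfies
  \<open>\<bar>p\<bar>\<^sup>2 \<le> 2 K \<delta>\<tau> \<bar>p\<bar> + 1\<close>, which gives \<open>\<bar>p\<bar> \<le> 1 + 2 K \<delta>\<tau>\<close>. The two roots sum to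
  \<open>2 \<gamma>\<^sub>1 / \<gamma>\<^sub>0 = O(\<delta>\<tau>)\<close>, so they are nearly opposite, and a root away from the origin stays away
  from the other one.
\<close>

text \<open>Taking norms in \<open>c0 * p\<^sup>2 = 2 * c1 * p + c2\<close> and cancelling
  \<open>norm c0\<close> leaves \<open>norm p * (norm p - 2 * e) \<le> 1\<close>.\<close>

lemma norm_root_quadratic_le:
  fixes c0 c1 c2 p :: complex
  assumes c0: "1 \<le> norm c0" and c2: "norm c2 \<le> norm c0" and c1: "norm c1 \<le> e"
    and root: "poly [:- c2, - 2 * c1, c0:] p = 0"
  shows "norm p \<le> 1 + 2 * e"
proof (rule ccontr)
  assume "\<not> ?thesis"
  hence large: "norm p > 1 + 2 * e" by simp
  have e: "0 \<le> e" using c1 norm_ge_zero[of c1] by linarith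
  have "c0 * p\<^sup>2 = 2 * c1 * p + c2"
    using root by (simp add: algebra_simps power2_eq_square)
  hence "norm c0 * (norm p)\<^sup>2 = norm (2 * c1 * p + c2)"
    by (metis norm_mult norm_power)
  also have "\<dots> \<le> 2 * norm c1 * norm p + norm c2"
    using norm_triangle_ineq[of "2 * c1 * p" c2] by (simp add: norm_mult)
  also have "\<dots> \<le> norm c0 * (2 * e * norm p) + norm c0"
  proof -
    \<comment> \<open>The factor 1 is inserted so that \<open>1 \<le> norm c0\<close> can replace
      it, which makes \<open>norm c0\<close> a common factor of both terms.\<close>
    have "2 * norm c1 * norm p \<le> 1 * (2 * e * norm p)"
      using c1 by (simp add: mult_right_mono)
    also have "\<dots> \<le> norm c0 * (2 * e * norm p)"
      using c0 e by (intro mult_right_mono) auto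
    finally show ?thesis using c2 by simp
  qed
  also have "\<dots> = norm c0 * (2 * e * norm p + 1)"
    by (simp add: algebra_simps)
  finally have "(norm p)\<^sup>2 \<le> 2 * e * norm p + 1"
    using c0 by (subst (asm) mult_le_cancel_left_pos) auto
  hence "norm p * (norm p - 2 * e) \<le> 1"
    by (simp add: algebra_simps power2_eq_square)
  \<comment> \<open>Under the contrary assumption both factors exceed 1.\<close>
  moreover have "1 * 1 < norm p * (norm p - 2 * e)"
    using large e by (intro mult_strict_mono) auto
  ultimately show False by simp
qed

text \<open>By Vieta the second root is \<open>2 * c1 / c0 - p\<close>; the root equation eliminates
  \<open>c2\<close>.\<close>

lemma quadratic_factorization:
  fixes c0 c1 c2 p :: complex
  assumes "c0 \<noteq> 0" and root: "poly [:- c2, - 2 * c1, c0:] p = 0"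
  shows "[:- c2, - 2 * c1, c0:] = smult c0 ([:- p, 1:] * [:- (2 * c1 / c0 - p), 1:])"
proof -
  have "c2 = p * (c0 * p - 2 * c1)"
    using root by (simp add: algebra_simps)
  thus ?thesis using \<open>c0 \<noteq> 0\<close> by (simp add: algebra_simps)
qed

text \<open>The two roots differ by \<open>2 * c1 / c0 - 2 * p\<close>, and the first term has norm
  at most \<open>2 * e\<close>. For \<open>e < norm p\<close> the difference is nonzero, so the root
  is simple.\<close>

lemma quadratic_root_separation:
  fixes c0 c1 c2 p :: complex
  assumes c0: "1 \<le> norm c0" and c1: "norm c1 \<le> e"
    and root: "poly [:- c2, - 2 * c1, c0:] p = 0" and large: "e < norm p"
  shows "order p [:- c2, - 2 * c1, c0:] = 1"
    and "poly [:- c2, - 2 * c1, c0:] q = 0 \<Longrightarrow> q \<noteq> p \<Longrightarrow> 2 * norm p - 2 * e \<le> norm (q - p)"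
proof -
  define p' where "p' = 2 * c1 / c0 - p"
  have nz: "c0 \<noteq> 0" using c0 by auto
  have fact: "[:- c2, - 2 * c1, c0:] = smult c0 ([:- p, 1:] * [:- p', 1:])"
    unfolding p'_def by (rule quadratic_factorization[OF nz root])
  have "norm (2 * c1 / c0) \<le> 2 * e"
  proof -
    have "norm (2 * c1 / c0) \<le> 2 * norm c1 / 1"
      unfolding norm_divide norm_mult norm_numeral using c0 by (intro divide_left_mono) auto
    thus ?thesis using c1 by simp
  qed
  moreover have "norm (p' - p) \<ge> norm (2 * p) - norm (2 * c1 / c0)"
    unfolding p'_def using norm_triangle_ineq2[of "2 * p" "2 * c1 / c0"]
    by (simp add: norm_minus_commute algebra_simps)
  ultimately have sep: "2 * norm p - 2 * e \<le> norm (p' - p)"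
    by (simp add: norm_mult)
  hence "p' \<noteq> p" using large by auto
  \<comment> \<open>The cofactor does not vanish at \<open>p\<close>, so additivity of
    \<open>order\<close> leaves only the contribution of the first factor.\<close>
  hence "order p [:- p', 1:] = 0"
    by (intro order_0I) simp
  moreover have "order p [:- p, 1:] = 1"
    using order_power_n_n[of p 1] by simp
  moreover have "order p ([:- p, 1:] * [:- p', 1:]) = order p [:- p, 1:] + order p [:- p', 1:]"
    by (rule order_mult) (simp only: mult_eq_0_iff, simp)
  ultimately show "order p [:- c2, - 2 * c1, c0:] = 1"
    unfolding fact order_smult[OF nz] by linarith
  assume "poly [:- c2, - 2 * c1, c0:] q = 0" and "q \<noteq> p"
  hence "q = p'" unfolding fact poly_smult poly_mult using nz by simp
  thus "2 * norm p - 2 * e \<le> norm (q - p)" using sep by simp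
qed

lemma normal_density_le:
  assumes "0 < \<sigma>"
  shows "normal_density \<mu> \<sigma> x \<le> 1 / sqrt (2 * pi * \<sigma>\<^sup>2)"
  unfolding normal_density_def using assms by (intro mult_left_le) auto

lemma kou_density_nonneg:
  assumes "0 \<le> p0" "p0 \<le> 1" "0 < lm" "0 < lp"
  shows "0 \<le> kou_density p0 lm lp x"
  using assms by (simp add: kou_density_def)

lemma kou_density_le:
  assumes "0 \<le> p0" "p0 \<le> 1" "0 < lm" "0 < lp"
  shows "kou_density p0 lm lp x \<le> lm + lp"
proof (cases "x \<ge> 0")
  case True
  have "((1 - p0) * lp) * exp (- lp * x) \<le> lp * 1"
    using assms True by (intro mult_mono mult_left_le_one_le) auto
  also have "\<dots> \<le> lm + lp" using assms by simp
  finally show ?thesis using True by (simp add: kou_density_def)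
next
  case False
  have "(p0 * lm) * exp (lm * x) \<le> lm * 1"
    using assms False by (intro mult_mono mult_left_le_one_le) (auto simp: mult_nonneg_nonpos)
  also have "\<dots> \<le> lm + lp" using assms by simp
  finally show ?thesis using False by (simp add: kou_density_def)
qed

text \<open>The bound is the Gaussian peak in the Merton case, and the sum of the two rates, which
  dominates either branch, in the Kou case.\<close>

lemma jump_density_bounded:
  assumes "jump_density g"
  obtains B where "0 \<le> B" "\<And>x. \<bar>g x\<bar> \<le> B"
proof -
  consider \<mu> \<sigma> where "\<sigma> > 0" "g = normal_density \<mu> \<sigma>"
    | p0 lm lp where "lm > 0" "lp > 1" "0 \<le> p0" "p0 \<le> 1" "g = kou_density p0 lm lp"
    using assms unfolding jump_density_def by blast
  thus thesis
  proof cases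
    case 1
    thus thesis using that[of "1 / sqrt (2 * pi * \<sigma>\<^sup>2)"] normal_density_le[of \<sigma> \<mu>] by simp
  next
    case 2
    thus thesis
      using that[of "lm + lp"] kou_density_le[of p0 lm lp] kou_density_nonneg[of p0 lm lp] by simp
  qed
qed

text \<open>There are \<open>N + 1\<close> terms of norm at most \<open>4 / 3 * B\<close>, and the
  factor \<open>2 * L / N\<close> compensates their number, so the bound is uniform in
  \<open>N\<close> and \<open>\<theta>\<close>.\<close>

lemma norm_simpson_symbol_le:
  assumes "0 \<le> L" "0 < N" "0 \<le> B" and B: "\<And>x. \<bar>g x\<bar> \<le> B"
  shows "norm (simpson_symbol g L N \<theta>) \<le> 16 / 3 * L * B"
proof -
  let ?f = "\<lambda>k. complex_of_real (simpson_weight N k) * exp (\<i> * complex_of_real (\<theta> * real k))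
                 * complex_of_real (g (grid_point L N k))"
  have "norm (sum ?f {0..N}) \<le> real (card {0..N}) * (4 / 3 * B)"
  proof (rule sum_norm_bound)
    fix k
    have "\<bar>simpson_weight N k\<bar> * \<bar>g (grid_point L N k)\<bar> \<le> 4 / 3 * B"
      using B by (intro mult_mono) (auto simp: simpson_weight_def)
    thus "norm (?f k) \<le> 4 / 3 * B"
      by (simp add: norm_mult)
  qed
  \<comment> \<open>\<open>N + 1 \<le> 2 * N\<close> since \<open>N\<close> is positive; this makes
    \<open>N\<close> cancel exactly against the step size.\<close>
  also have "\<dots> \<le> (2 * real N) * (4 / 3 * B)"
    using assms by (intro mult_right_mono) auto
  finally have "space_step L N * norm (sum ?f {0..N}) \<le> space_step L N * ((2 * real N) * (4 / 3 * B))"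
    using assms by (intro mult_left_mono) (auto simp: space_step_def)
  also have "\<dots> = 16 / 3 * L * B"
    using assms by (simp add: space_step_def)
  finally show ?thesis
    unfolding simpson_symbol_def norm_mult norm_of_real using assms by (simp add: space_step_def)
qed

lemma norm_gamma1_le:
  assumes "0 \<le> r" "0 \<le> lam" "0 \<le> dt" "norm G \<le> Gm"
  shows "norm (gamma1 r lam dt G) \<le> (lam * Gm + r + lam) * dt"
proof -
  have "norm (gamma1 r lam dt G) \<le> lam * dt * norm G + dt * (r + lam)"
    unfolding gamma1_def
    using assms
    by (intro order_trans[OF norm_triangle_ineq4])
      (simp add: norm_mult del: of_real_add flip: of_real_add)
  also have "\<dots> \<le> lam * dt * Gm + dt * (r + lam)"
    using assms by (intro add_right_mono mult_left_mono) auto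
  finally show ?thesis by (simp add: algebra_simps)
qed

lemma Re_compact_symbol_nonpos:
  assumes "0 \<le> a"
  shows "Re (compact_symbol a b dx \<theta>) \<le> 0"
proof -
  have c: "-1 \<le> cos \<theta>" "cos \<theta> \<le> 1" by auto
  have "(cos \<theta>)\<^sup>2 + 4 * cos \<theta> - 5 = (cos \<theta> - 1) * (cos \<theta> + 5)"
    by (simp add: algebra_simps power2_eq_square)
  also have "\<dots> \<le> 0" using c by (intro mult_nonpos_nonneg) linarith+
  \<comment> \<open>A nonnegative denominator suffices: for \<open>dx = 0\<close> the quotient is 0
    by convention.\<close>
  finally have "((cos \<theta>)\<^sup>2 + 4 * cos \<theta> - 5) / (dx\<^sup>2 * (2 + cos \<theta>)) \<le> 0"
    using c by (intro divide_nonpos_nonneg mult_nonneg_nonneg zero_le_power2) linarith+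
  with assms have "a * (((cos \<theta>)\<^sup>2 + 4 * cos \<theta> - 5) / (dx\<^sup>2 * (2 + cos \<theta>))) \<le> 0"
    by (rule mult_nonneg_nonpos)
  thus ?thesis by (simp add: compact_symbol_def)
qed

text \<open>With \<open>s\<close> in the closed left half-plane, \<open>1 - s\<close> has real part
  at least 1, and the squared norms of \<open>1 - s\<close> and \<open>1 + s\<close> differ by
  \<open>- 4 * Re s\<close>, which is nonnegative.\<close>

lemma norm_gamma0_gamma2:
  assumes "0 \<le> a" "0 \<le> dt"
  shows "1 \<le> norm (gamma0 a b dx dt \<theta>)"
    and "norm (gamma2 a b dx dt \<theta>) \<le> norm (gamma0 a b dx dt \<theta>)"
proof -
  define s where "s = complex_of_real dt * compact_symbol a b dx \<theta>"
  have s: "Re s \<le> 0"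
    using assms Re_compact_symbol_nonpos[OF assms(1)] by (simp add: s_def mult_nonneg_nonpos)
  have "1 \<le> Re (1 - s)" using s by simp
  also have "\<dots> \<le> norm (1 - s)" by (rule complex_Re_le_cmod)
  finally show "1 \<le> norm (gamma0 a b dx dt \<theta>)" by (simp add: gamma0_def s_def)
  have "(norm (1 + s))\<^sup>2 \<le> (norm (1 - s))\<^sup>2"
    using s unfolding cmod_power2 by (simp add: power2_eq_square algebra_simps)
  hence "norm (1 + s) \<le> norm (1 - s)"
    by (rule power2_le_imp_le) simp
  thus "norm (gamma2 a b dx dt \<theta>) \<le> norm (gamma0 a b dx dt \<theta>)"
    by (simp add: gamma0_def gamma2_def s_def)
qed

theorem theorem5p2:
  fixes \<sigma> r lam L T :: real and g :: "real \<Rightarrow> real"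
  assumes "\<sigma> > 0" and "r \<ge> 0" and "lam > 0" and "L > 0" and "T > 0"
    and "jump_density g"
  shows "\<exists>C::real.
    (\<forall>(N::nat) (M::nat) (\<theta>::real) (pu::complex).
        N > 0 \<and> even N \<and> M > 0 \<and> time_step T M \<le> 1 / (4 * lam + 2 * r) \<and> \<theta> \<in> {-pi..pi} \<and>
        poly (amplification_poly \<sigma> r lam g L N (time_step T M) \<theta>) pu = 0
        \<longrightarrow> cmod pu \<le> 1 + C * time_step T M) \<and>
    (\<exists>(a0::real) (a1::real). 0 < a0 \<and> a0 < 1 \<and> 0 < a1 \<and>
      (\<exists>h>0. \<forall>(N::nat) (M::nat) (\<theta>::real) (pu::complex).
        N > 0 \<and> even N \<and> M > 0 \<and> time_step T M \<le> 1 / (4 * lam + 2 * r) \<and> \<theta> \<in> {-pi..pi} \<and>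
        space_step L N < h \<and> time_step T M < h \<and>
        poly (amplification_poly \<sigma> r lam g L N (time_step T M) \<theta>) pu = 0 \<and>
        a0 < cmod pu \<and> cmod pu \<le> 1 + C * time_step T M
        \<longrightarrow> order pu (amplification_poly \<sigma> r lam g L N (time_step T M) \<theta>) = 1 \<and>
            (\<forall>pv. poly (amplification_poly \<sigma> r lam g L N (time_step T M) \<theta>) pv = 0 \<and> pv \<noteq> pu
                  \<longrightarrow> a1 \<le> cmod (pv - pu))))"
proof -
  obtain B where B: "0 \<le> B" "\<And>x. \<bar>g x\<bar> \<le> B"
    using jump_density_bounded[OF \<open>jump_density g\<close>] by blast
  \<comment> \<open>This is the constant of \<open>norm_gamma1_le\<close> with the uniform Simpson
    bound inserted for \<open>Gm\<close>.\<close>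
  define K where "K = lam * (16 / 3 * L * B) + r + lam"
  have K: "0 < K" using assms B(1) by (simp add: K_def add_nonneg_pos)
  let ?P = "\<lambda>N M \<theta>. amplification_poly \<sigma> r lam g L N (time_step T M) \<theta>"
  \<comment> \<open>The coefficients are hidden behind existentials so that the rest concerns only
    an abstract quadratic with three norm bounds.\<close>
  have coeffs: "\<exists>c0 c1 c2. ?P N M \<theta> = [:- c2, - 2 * c1, c0:] \<and> 1 \<le> norm c0 \<and>
      norm c2 \<le> norm c0 \<and> norm c1 \<le> K * time_step T M" if "N > 0" for N M \<theta>
  proof -
    have dt: "0 \<le> time_step T M" using \<open>T > 0\<close> by (simp add: time_step_def)
    have a: "0 \<le> diffusion_coeff \<sigma>" by (simp add: diffusion_coeff_def)
    have "norm (simpson_symbol g L N \<theta>) \<le> 16 / 3 * L * B"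
      using assms B that by (intro norm_simpson_symbol_le) auto
    hence "norm (gamma1 r lam (time_step T M) (simpson_symbol g L N \<theta>)) \<le> K * time_step T M"
      unfolding K_def using assms dt by (intro norm_gamma1_le) auto
    thus ?thesis
      using norm_gamma0_gamma2[OF a dt] unfolding amplification_poly_def Let_def by blast
  qed
  have bound: "norm pu \<le> 1 + 2 * K * time_step T M"
    if "N > 0" "poly (?P N M \<theta>) pu = 0" for N M \<theta> pu
    using coeffs[OF that(1), of M \<theta>] that(2) norm_root_quadratic_le by (metis mult.assoc)
  have separation: "order pu (?P N M \<theta>) = 1 \<and>
      (\<forall>pv. poly (?P N M \<theta>) pv = 0 \<and> pv \<noteq> pu \<longrightarrow> 1 / 2 \<le> norm (pv - pu))"
    if "N > 0" and small: "time_step T M < 1 / (4 * K)"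
      and root: "poly (?P N M \<theta>) pu = 0" and pu: "1 / 2 < norm pu" for N M \<theta> pu
  proof -
    obtain c0 c1 c2 where P: "?P N M \<theta> = [:- c2, - 2 * c1, c0:]"
      and c: "1 \<le> norm c0" "norm c1 \<le> K * time_step T M"
      using coeffs[OF \<open>N > 0\<close>] by blast
    have e: "K * time_step T M < 1 / 4"
      using small K by (simp add: field_simps)
    have "K * time_step T M < norm pu" using e pu by linarith
    note sep = quadratic_root_separation[OF c root[unfolded P] this]
    \<comment> \<open>With \<open>e = K * time_step T M\<close> below 1/4 and \<open>norm pu\<close>
      above 1/2, the distance \<open>2 * norm pu - 2 * e\<close> exceeds 1 - 1/2.\<close>
    show ?thesis
      unfolding P using sep(1) sep(2) e pu by fastforce
  qed
  show ?thesis
    \<comment> \<open>\<open>C\<close> is \<open>2 * K\<close>, \<open>1 / 2\<close> serves as both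
      \<open>a0\<close> and \<open>a1\<close>, and \<open>h\<close> is \<open>1 / (4 * K)\<close>,
      the threshold in \<open>separation\<close>.\<close>
    by (rule exI[of _ "2 * K"], intro conjI exI[of _ "1 / 2 :: real"] exI[of _ "1 / (4 * K)"])
      (use K bound separation in auto)
qed

end
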